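(* Let $D$ be an integral domain that is an intersection of localizations at divisorial prime ideals, i.e. $D=\bigcap_{P\in F}D_P$ for some set $F$ of divisorial prime ideals of $D$. If the power series ring $D[[X]]$ is a Prüfer $v$-multiplication domain (PVMD), then $D$ is a $v$-domain that is an intersection of essential discrete rank-one valuation domains, and thus $D$ is completely integrally closed.
   Context: For an integral domain $R$ with quotient field $K$: for a nonzero fractional ideal $I$ put $I^{-1}=\{x\in K\mid xI\subseteq R\}$, $I_v=(I^{-1})^{-1}$, and $I_t=\bigcup\{J_v\mid J\subseteq I,\ J \text{ a nonzero finitely generated fractional ideal}\}$. A nonzero fractional ideal $I$ is divisorial (a $v$-ideal) if $I_v=I$. $R$ is a PVMD if $(II^{-1})_t=R$ for every nonzero finitely generated ideal $I$ of $R$; $R$ is a $v$-domain if $(II^{-1})_v=R$ for every nonzero finitely generated ideal $I$ of $R$. An essential valuation domain of $R$ is a valuation overring of the form $V=R_P$ for some prime ideal $P$ of $R$. $R$ is completely integrally closed if whenever $x\in K$ and $0\ne r\in R$ satisfy $rx^n\in R$ for every integer $n\ge 1$, then $x\in R$. *)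

theory Defs
  imports "HOL-Computational_Algebra.Computational_Algebra"
begin

text \<open>
  The domain \<open>R\<close> is a type of class \<open>idom\<close>, its quotient field is the type of fractions over it,
  and \<open>R\<close> is identified with its image \<open>base_ring\<close> in the quotient field. All ideals (integral
  or fractional) and all overrings are sets of elements of the quotient field. Fractional ideals
  are \<open>R\<close>-submodules in the sense of the library locale \<open>module\<close>.
\<close>

global_interpretation frac: module "\<lambda>(r :: 'a :: idom) (x :: 'a fract). to_fract r * x"
  defines frac_subspace = frac.subspace and frac_span = frac.span
  by unfold_locales (simp_all add: algebra_simps)

definition base_ring :: "'a :: idom fract set" where
  "base_ring = range to_fract"

definition fractional_ideal :: "'a :: idom fract set \<Rightarrow> bool" where
  "fractional_ideal I \<longleftrightarrow>
     frac_subspace I \<and> (\<exists>d :: 'a. d \<noteq> 0 \<and> (\<forall>x\<in>I. to_fract d * x \<in> base_ring))"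

definition nonzero_fractional_ideal :: "'a :: idom fract set \<Rightarrow> bool" where
  "nonzero_fractional_ideal I \<longleftrightarrow> fractional_ideal I \<and> I \<noteq> {0}"

definition finitely_generated :: "'a :: idom fract set \<Rightarrow> bool" where
  "finitely_generated I \<longleftrightarrow> (\<exists>S. finite S \<and> I = frac_span S)"

definition ideal_of_ring :: "'a :: idom fract set \<Rightarrow> bool" where
  "ideal_of_ring I \<longleftrightarrow> frac_subspace I \<and> I \<subseteq> base_ring"

definition prime_ideal_of_ring :: "'a :: idom fract set \<Rightarrow> bool" where
  "prime_ideal_of_ring P \<longleftrightarrow>
     ideal_of_ring P \<and> P \<noteq> base_ring \<and>
     (\<forall>a\<in>base_ring. \<forall>b\<in>base_ring. a * b \<in> P \<longrightarrow> a \<in> P \<or> b \<in> P)"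

definition ideal_inverse :: "'a :: idom fract set \<Rightarrow> 'a fract set" where
  "ideal_inverse I = {x. \<forall>y\<in>I. x * y \<in> base_ring}"

definition ideal_prod :: "'a :: idom fract set \<Rightarrow> 'a fract set \<Rightarrow> 'a fract set" where
  "ideal_prod I J = frac_span {x * y | x y. x \<in> I \<and> y \<in> J}"

definition v_closure :: "'a :: idom fract set \<Rightarrow> 'a fract set" where
  "v_closure I = ideal_inverse (ideal_inverse I)"

definition t_closure :: "'a :: idom fract set \<Rightarrow> 'a fract set" where
  "t_closure I =
     \<Union> {v_closure J | J. J \<subseteq> I \<and> nonzero_fractional_ideal J \<and> finitely_generated J}"

definition divisorial :: "'a :: idom fract set \<Rightarrow> bool" where
  "divisorial I \<longleftrightarrow> nonzero_fractional_ideal I \<and> v_closure I = I"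

definition pvmd :: "'a :: idom itself \<Rightarrow> bool" where
  "pvmd (_ :: 'a itself) \<longleftrightarrow>
     (\<forall>I :: 'a fract set. ideal_of_ring I \<and> I \<noteq> {0} \<and> finitely_generated I \<longrightarrow>
        t_closure (ideal_prod I (ideal_inverse I)) = base_ring)"

definition v_domain :: "'a :: idom itself \<Rightarrow> bool" where
  "v_domain (_ :: 'a itself) \<longleftrightarrow>
     (\<forall>I :: 'a fract set. ideal_of_ring I \<and> I \<noteq> {0} \<and> finitely_generated I \<longrightarrow>
        v_closure (ideal_prod I (ideal_inverse I)) = base_ring)"

definition localization_at :: "'a :: idom fract set \<Rightarrow> 'a fract set" where
  "localization_at P = {a / s | a s. a \<in> base_ring \<and> s \<in> base_ring - P}"

definition overring :: "'a :: idom fract set \<Rightarrow> bool" where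
  "overring V \<longleftrightarrow>
     base_ring \<subseteq> V \<and> (\<forall>x\<in>V. \<forall>y\<in>V. x - y \<in> V \<and> x * y \<in> V)"

definition valuation_overring :: "'a :: idom fract set \<Rightarrow> bool" where
  "valuation_overring V \<longleftrightarrow> overring V \<and> (\<forall>x. x \<noteq> 0 \<longrightarrow> x \<in> V \<or> inverse x \<in> V)"

definition essential_valuation_domain :: "'a :: idom fract set \<Rightarrow> bool" where
  "essential_valuation_domain V \<longleftrightarrow>
     valuation_overring V \<and> (\<exists>P. prime_ideal_of_ring P \<and> V = localization_at P)"

text \<open>
  A discrete rank-one valuation domain is the valuation ring of a valuation whose value group is
  the group of integers. The value at \<open>0\<close> is irrelevant, and surjectivity excludes the trivial
  valuation, so the field itself is not of this kind.
\<close>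

definition discrete_rank_one_valuation_domain :: "'k :: field set \<Rightarrow> bool" where
  "discrete_rank_one_valuation_domain V \<longleftrightarrow>
     (\<exists>w :: 'k \<Rightarrow> int.
        w ` (UNIV - {0}) = UNIV \<and>
        (\<forall>x y. x \<noteq> 0 \<longrightarrow> y \<noteq> 0 \<longrightarrow> w (x * y) = w x + w y) \<and>
        (\<forall>x y. x \<noteq> 0 \<longrightarrow> y \<noteq> 0 \<longrightarrow> x + y \<noteq> 0 \<longrightarrow> min (w x) (w y) \<le> w (x + y)) \<and>
        V = {x. x = 0 \<or> 0 \<le> w x})"

definition completely_integrally_closed :: "'a :: idom itself \<Rightarrow> bool" where
  "completely_integrally_closed (_ :: 'a itself) \<longleftrightarrow>
     (\<forall>(x :: 'a fract) r. r \<in> base_ring \<and> r \<noteq> 0 \<and> (\<forall>n\<ge>1. r * x ^ n \<in> base_ring) \<longrightarrow>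
        x \<in> base_ring)"

end

theory Submission
  imports Defs
begin

text \<open>
  Let \<open>P\<close> be a divisorial prime of \<open>D\<close>. Then \<open>P[[X]]\<close> is divisorial in the PVMD \<open>D[[X]]\<close>, so of any
  two power series \<open>f\<close>, \<open>g\<close> one divides the other in the localization of \<open>D[[X]]\<close> at \<open>P[[X]]\<close>. For
  constants this says that \<open>D\<^sub>P\<close> is a valuation domain. If \<open>D\<^sub>P\<close> were not discrete of rank one,
  there would be \<open>a\<^sub>0, a\<^sub>1, \<dots>\<close> in \<open>D\<close> with strictly decreasing values. Put
  \<open>f = \<Sum> a\<^sub>k X\<^bsup>k\<^sup>2\<^esup>\<close> over the even and \<open>g = \<Sum> a\<^sub>k X\<^bsup>k\<^sup>2\<^esup>\<close> over the odd \<open>k\<close>. If \<open>u f = h g\<close> with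
  \<open>u\<^sub>i \<notin> P\<close>, then for even \<open>k \<ge> i\<close> the coefficient of index \<open>k\<^sup>2 + i\<close> has the value of \<open>a\<^sub>k\<close> on the
  left and a strictly larger value on the right; symmetrically for \<open>u g = h f\<close>.

  Intersections of discrete rank-one valuation domains are completely integrally closed, and this
  makes \<open>D\<close> a \<open>v\<close>-domain: an \<open>x\<close> in the inverse of \<open>I I\<^sup>-\<^sup>1\<close> maps \<open>I\<^sup>-\<^sup>1\<close> into itself, so that
  \<open>d x\<^sup>n \<in> D\<close> for all \<open>n\<close> whenever \<open>0 \<noteq> d \<in> I \<subseteq> D\<close>.
\<close>

section \<open>Submodules and quotients over the base ring\<close>

lemma to_fract_in_base_ring [simp]: "to_fract a \<in> base_ring"
  by (simp add: base_ring_def)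

lemma one_in_base_ring [simp]: "1 \<in> base_ring"
  using to_fract_in_base_ring[of 1] by simp

lemma base_ring_mult: "x \<in> base_ring \<Longrightarrow> y \<in> base_ring \<Longrightarrow> x * y \<in> base_ring"
  by (auto simp: base_ring_def simp flip: to_fract_mult)

lemma to_fract_power: "to_fract (a ^ n) = to_fract a ^ n"
  by (induction n) auto

text \<open>Through \<open>frac.span_minimal\<close>, a statement that \<open>z\<close> multiplies a
  spanned ideal into the base ring needs checking on generators only.\<close>

lemma frac_subspace_colon: "frac_subspace {w. z * w \<in> base_ring}"
proof (rule frac.subspaceI)
  show "0 \<in> {w. z * w \<in> base_ring}"
    using to_fract_in_base_ring[of 0] by simp
next
  fix x y assume "x \<in> {w. z * w \<in> base_ring}" "y \<in> {w. z * w \<in> base_ring}"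
  then obtain a b where "z * x = to_fract a" "z * y = to_fract b"
    by (auto simp: base_ring_def)
  then have "z * (x + y) = to_fract (a + b)"
    by (simp add: distrib_left)
  then show "x + y \<in> {w. z * w \<in> base_ring}"
    by (simp only: mem_Collect_eq to_fract_in_base_ring)
next
  fix c x assume "x \<in> {w. z * w \<in> base_ring}"
  then show "to_fract c * x \<in> {w. z * w \<in> base_ring}"
    using base_ring_mult[OF to_fract_in_base_ring[of c], of "z * x"]
    by (simp add: mult.left_commute)
qed

lemma frac_subspace_base_ring: "frac_subspace base_ring"
  using frac_subspace_colon[of 1] by simp

lemma fract_quotientE:
  fixes x :: "'a :: idom fract"
  obtains a b where "b \<noteq> 0" "x = to_fract a / to_fract b"
  by (metis Fract_conv_to_fract Fract_cases)

lemma quotient_in_base_ring_iff: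
  assumes "b \<noteq> 0"
  shows "to_fract a / to_fract b \<in> base_ring \<longleftrightarrow> b dvd a"
proof
  assume "to_fract a / to_fract b \<in> base_ring"
  then obtain c where "to_fract a / to_fract b = to_fract c"
    by (auto simp: base_ring_def)
  then have "to_fract a = to_fract (b * c)"
    using assms by (simp add: field_simps)
  then show "b dvd a" by (simp only: to_fract_eq_iff dvd_triv_left)
next
  assume "b dvd a"
  then show "to_fract a / to_fract b \<in> base_ring"
    using assms by (auto elim!: dvdE)
qed

section \<open>Inverses of ideals, PVMDs and v-domains\<close>

lemma ideal_prod_inverse_subset_base_ring: "ideal_prod I (ideal_inverse I) \<subseteq> base_ring"
  unfolding ideal_prod_def
  by (rule frac.span_minimal[OF _ frac_subspace_base_ring])
     (auto simp: ideal_inverse_def mult.commute)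

lemma mult_in_ideal_prod: "x \<in> I \<Longrightarrow> y \<in> J \<Longrightarrow> x * y \<in> ideal_prod I J"
  unfolding ideal_prod_def by (rule frac.span_base) auto

text \<open>Some \<open>J\<close> inside the product has 1 in \<open>v_closure J\<close>. Hence
  whatever multiplies \<open>J\<close> into the base ring already lies there, and \<open>z\<close>
  does so.\<close>

lemma pvmd_inverse_of_prod:
  fixes I :: "'a :: idom fract set"
  assumes "pvmd TYPE('a)" "ideal_of_ring I" "I \<noteq> {0}" "finitely_generated I"
    and z: "\<And>w. w \<in> ideal_prod I (ideal_inverse I) \<Longrightarrow> z * w \<in> base_ring"
  shows "z \<in> base_ring"
proof -
  have "1 \<in> t_closure (ideal_prod I (ideal_inverse I))"
    using assms(1-4) by (simp add: pvmd_def)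
  then obtain J where J: "J \<subseteq> ideal_prod I (ideal_inverse I)" "1 \<in> v_closure J"
    by (auto simp: t_closure_def)
  have "z \<in> ideal_inverse J"
    using J(1) z by (auto simp: ideal_inverse_def)
  with J(2) show ?thesis
    by (auto simp: v_closure_def ideal_inverse_def)
qed

lemma v_domain_if_completely_integrally_closed:
  assumes cic: "completely_integrally_closed TYPE('a :: idom)"
  shows "v_domain TYPE('a)"
  unfolding v_domain_def
proof (intro allI impI)
  fix I :: "'a fract set"
  assume I: "ideal_of_ring I \<and> I \<noteq> {0} \<and> finitely_generated I"
  then have sub: "I \<subseteq> base_ring" and "0 \<in> I"
    by (auto simp: ideal_of_ring_def intro: frac.subspace_0)
  with I obtain d where d: "d \<in> I" "d \<noteq> 0" by blast
  let ?A = "ideal_prod I (ideal_inverse I)"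
  have "x \<in> base_ring" if x: "x \<in> ideal_inverse ?A" for x
  proof -
    have step: "x * y \<in> ideal_inverse I" if y: "y \<in> ideal_inverse I" for y
    proof -
      have "x * (z * y) \<in> base_ring" if "z \<in> I" for z
        using x mult_in_ideal_prod[OF that y] by (simp add: ideal_inverse_def)
      then show ?thesis by (simp add: ideal_inverse_def mult_ac)
    qed
    \<comment> \<open>The induction starts because \<open>I\<close> is integral, which puts 1 into
      its inverse.\<close>
    have "x ^ n \<in> ideal_inverse I" for n
    proof (induction n)
      case 0
      show ?case using sub by (auto simp: ideal_inverse_def)
    qed (use step in auto)
    then have "\<forall>n. d * x ^ n \<in> base_ring"
      using d by (auto simp: ideal_inverse_def mult.commute)
    with d sub cic show ?thesis
      unfolding completely_integrally_closed_def by blast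
  qed
  moreover have "base_ring \<subseteq> ideal_inverse ?A"
    using ideal_prod_inverse_subset_base_ring[of I]
    by (auto simp: ideal_inverse_def intro: base_ring_mult)
  ultimately have "ideal_inverse ?A = base_ring" by blast
  moreover have "ideal_inverse base_ring = (base_ring :: 'a fract set)"
    by (auto simp: ideal_inverse_def intro: base_ring_mult dest: bspec[of _ _ 1])
  ultimately show "v_closure ?A = base_ring"
    by (simp add: v_closure_def)
qed

section \<open>Comparability of power series over a PVMD\<close>

text \<open>
  The element \<open>a / b\<close> plays the role of an element of \<open>P\<^sup>-\<^sup>1\<close> outside \<open>D\<close>, where \<open>P\<close> is
  divisorial with elements \<open>Q\<close>. If all products \<open>x f\<close>, \<open>x g\<close> with \<open>x\<close> in the inverse of
  \<open>I = (f, g)\<close> had coefficients in \<open>Q\<close>, then \<open>a / b\<close> would be in the inverse of \<open>I I\<^sup>-\<^sup>1\<close>.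
\<close>

lemma pvmd_fps_comparable:
  fixes Q :: "'a :: idom set" and f g :: "'a fps"
  assumes pvmd: "pvmd TYPE('a fps)"
    and Q: "\<And>q. q \<in> Q \<Longrightarrow> b dvd a * q" and b: "b \<noteq> 0" "\<not> b dvd a"
  shows "\<exists>u h. (\<exists>i. fps_nth u i \<notin> Q) \<and> (u * f = h * g \<or> u * g = h * f)"
proof (cases "f = 0 \<and> g = 0")
  case True
  \<comment> \<open>The PVMD condition says nothing about the zero ideal. Here \<open>u = 1\<close>
    works, since 1 in \<open>Q\<close> would give \<open>b dvd a\<close>.\<close>
  have "1 \<notin> Q" using Q[of 1] b by auto
  then show ?thesis
    using True by (intro exI[of _ 1] conjI exI[of _ 0]) auto
next
  case False
  show ?thesis
  proof (rule ccontr)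
    assume contra: "\<not> ?thesis"
    define I where "I = frac_span {to_fract f, to_fract g}"
    have fg: "to_fract f \<in> I" "to_fract g \<in> I"
      unfolding I_def by (auto intro: frac.span_base)
    have I: "ideal_of_ring I"
      unfolding ideal_of_ring_def I_def
      by (intro conjI frac.subspace_span frac.span_minimal frac_subspace_base_ring) auto
    have "I \<noteq> {0}" using fg False by auto
    have "finitely_generated I"
      unfolding finitely_generated_def I_def by (intro exI[of _ "{to_fract f, to_fract g}"]) simp
    define z where "z = to_fract (fps_const a) / to_fract (fps_const b)"
    have zu: "z * to_fract u \<in> base_ring" if u: "\<And>i. fps_nth u i \<in> Q" for u
    proof -
      obtain c where c: "\<And>i. a * fps_nth u i = b * c i"
        using Q[OF u] unfolding dvd_def by metis
      have "fps_const a * u = fps_const b * Abs_fps c"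
        using c by (simp add: fps_eq_iff)
      then have "z * to_fract u = to_fract (Abs_fps c)"
        using b(1) unfolding z_def
        by (simp add: field_simps flip: to_fract_mult)
      then show ?thesis by simp
    qed
    have "z * w \<in> base_ring" if w: "w \<in> ideal_prod I (ideal_inverse I)" for w
    proof -
      have "z * (y * x) \<in> base_ring" if y: "y \<in> I" and x: "x \<in> ideal_inverse I" for x y
      proof -
        obtain u h where u: "x * to_fract f = to_fract u" and h: "x * to_fract g = to_fract h"
          using fg x unfolding ideal_inverse_def base_ring_def by blast
        have "to_fract u * to_fract g = to_fract h * to_fract f"
          by (simp flip: u h)
        then have "u * g = h * f"
          by (metis to_fract_eq_iff to_fract_mult)
        \<comment> \<open>The relation also compares \<open>f\<close> and \<open>g\<close> with
          \<open>h\<close> and \<open>u\<close> exchanged, so the contrary assumption applies to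
          both.\<close>
        then have "fps_nth u i \<in> Q" "fps_nth h i \<in> Q" for i
          using contra by (metis)+
        then have "z * to_fract u \<in> base_ring" "z * to_fract h \<in> base_ring"
          by (intro zu; simp)+
        then have "{to_fract f, to_fract g} \<subseteq> {y. (z * x) * y \<in> base_ring}"
          by (simp add: mult.assoc u h)
        then have "I \<subseteq> {y. (z * x) * y \<in> base_ring}"
          unfolding I_def by (rule frac.span_minimal[OF _ frac_subspace_colon])
        with y show ?thesis by (auto simp: mult_ac)
      qed
      then have "ideal_prod I (ideal_inverse I) \<subseteq> {w. z * w \<in> base_ring}"
        unfolding ideal_prod_def by (intro frac.span_minimal frac_subspace_colon) auto
      with w show ?thesis by blast
    qed
    with pvmd I \<open>I \<noteq> {0}\<close> \<open>finitely_generated I\<close> have "z \<in> base_ring"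
      by (rule pvmd_inverse_of_prod)
    then have "fps_const b dvd fps_const a"
      unfolding z_def using b(1) by (subst (asm) quotient_in_base_ring_iff) auto
    then obtain k where "fps_const a = fps_const b * k" ..
    then have "a = b * fps_nth k 0"
      by (metis fps_mult_left_const_nth fps_nth_fps_const)
    with b(2) show False by simp
  qed
qed

section \<open>Prime ideals and proper multiples in the localization\<close>

locale prime_ideal_set =
  fixes Q :: "'a :: idom set"
  assumes zero_mem: "0 \<in> Q"
    and add_mem: "x \<in> Q \<Longrightarrow> y \<in> Q \<Longrightarrow> x + y \<in> Q"
    and mult_mem: "x \<in> Q \<Longrightarrow> r * x \<in> Q"
    and one_notin: "1 \<notin> Q"
    and prime: "x * y \<in> Q \<Longrightarrow> x \<in> Q \<or> y \<in> Q"
begin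

lemma mult_notin: "x \<notin> Q \<Longrightarrow> y \<notin> Q \<Longrightarrow> x * y \<notin> Q"
  using prime by blast

lemma notin_imp_nonzero: "s \<notin> Q \<Longrightarrow> s \<noteq> 0"
  using zero_mem by auto

text \<open>These are the elements of \<open>D \<inter> a P D\<^sub>P\<close>.\<close>

definition proper_multiples :: "'a \<Rightarrow> 'a set" where
  "proper_multiples a = {x. \<exists>s q. s \<notin> Q \<and> q \<in> Q \<and> s * x = a * q}"

lemma proper_multiplesI: "s \<notin> Q \<Longrightarrow> q \<in> Q \<Longrightarrow> s * x = a * q \<Longrightarrow> x \<in> proper_multiples a"
  unfolding proper_multiples_def by blast

lemma proper_multiplesE:
  assumes "x \<in> proper_multiples a"
  obtains s q where "s \<notin> Q" "q \<in> Q" "s * x = a * q"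
  using assms unfolding proper_multiples_def by blast

lemma zero_proper_multiple: "0 \<in> proper_multiples a"
  by (rule proper_multiplesI[OF one_notin zero_mem]) simp

lemma proper_multiples_mult: "x \<in> proper_multiples a \<Longrightarrow> r * x \<in> proper_multiples a"
proof (elim proper_multiplesE)
  fix s q assume "s \<notin> Q" "q \<in> Q" "s * x = a * q"
  then show "r * x \<in> proper_multiples a"
    by (intro proper_multiplesI[of s "r * q"] mult_mem) (auto simp: mult.left_commute)
qed

lemma proper_multiples_add:
  assumes "x \<in> proper_multiples a" "y \<in> proper_multiples a"
  shows "x + y \<in> proper_multiples a"
proof -
  obtain s q s' q' where "s \<notin> Q" "q \<in> Q" "s * x = a * q" "s' \<notin> Q" "q' \<in> Q" "s' * y = a * q'"
    using assms by (metis proper_multiplesE)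
  moreover from this have "(s' * s) * (x + y) = a * (s' * q + s * q')"
    by (simp add: algebra_simps)
  ultimately show ?thesis
    by (intro proper_multiplesI[of "s' * s" "s' * q + s * q'"] mult_notin add_mem mult_mem)
qed

lemma proper_multiples_diff:
  "x \<in> proper_multiples a \<Longrightarrow> y \<in> proper_multiples a \<Longrightarrow> x - y \<in> proper_multiples a"
  using proper_multiples_add[of x a "-1 * y"] proper_multiples_mult[of y a "-1"] by simp

lemma proper_multiples_sum:
  "(\<And>i. i \<in> A \<Longrightarrow> f i \<in> proper_multiples a) \<Longrightarrow> sum f A \<in> proper_multiples a"
  by (induction A rule: infinite_finite_induct)
     (auto intro: zero_proper_multiple proper_multiples_add)

lemma proper_multiples_trans:
  assumes "x \<in> proper_multiples a" "a \<in> proper_multiples b"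
  shows "x \<in> proper_multiples b"
proof -
  obtain s q s' q' where *: "s \<notin> Q" "q \<in> Q" "s * x = a * q" "s' \<notin> Q" "q' \<in> Q" "s' * a = b * q'"
    using assms by (metis proper_multiplesE)
  have "s' * s * x = (s' * a) * q" using *(3) by (simp add: mult_ac)
  also have "\<dots> = b * (q' * q)" using *(6) by (simp add: mult_ac)
  finally show ?thesis
    using * by (intro proper_multiplesI[of "s' * s" "q' * q"] mult_notin mult_mem)
qed

text \<open>Cancelling \<open>a\<close> leaves \<open>s * r = q\<close>, and primality discards
  \<open>s\<close>. In terms of values: a factor outside \<open>Q\<close> cannot raise the value of
  \<open>a\<close>.\<close>

lemma mult_proper_multiple_imp_mem:
  assumes "r * a \<in> proper_multiples a" "a \<noteq> 0"
  shows "r \<in> Q"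
proof -
  obtain s q where *: "s \<notin> Q" "q \<in> Q" "s * (r * a) = a * q"
    using assms(1) by (rule proper_multiplesE)
  then have "a * (s * r) = a * q" by (simp add: mult_ac)
  with assms(2) have "s * r = q" by simp
  with * show ?thesis using prime by blast
qed

end

section \<open>Lacunary power series\<close>

text \<open>Squares are chosen as exponents only because their gaps grow beyond every bound.\<close>

definition lacunary :: "(nat \<Rightarrow> 'a :: comm_ring_1) \<Rightarrow> nat set \<Rightarrow> 'a fps" where
  "lacunary a E = Abs_fps (\<lambda>n. if n \<in> (\<lambda>k. k\<^sup>2) ` E then a (inv (\<lambda>k. k\<^sup>2) n) else 0)"

lemma lacunary_nth_square: "fps_nth (lacunary a E) (k\<^sup>2) = (if k \<in> E then a k else 0)"
proof -
  have "inj (\<lambda>k :: nat. k\<^sup>2)" by (auto intro: injI)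
  then have "inv (\<lambda>k. k\<^sup>2) (k\<^sup>2) = k" using inv_f_f by fastforce
  then show ?thesis by (auto simp: lacunary_def)
qed

lemma lacunary_nth_nonsquare: "(\<And>k. n \<noteq> k\<^sup>2) \<Longrightarrow> fps_nth (lacunary a E) n = 0"
  by (auto simp: lacunary_def)

context prime_ideal_set
begin

text \<open>Only squares up to \<open>k\<^sup>2\<close> contribute to this coefficient. The smaller
  ones carry some \<open>a m\<close> with \<open>m < k\<close>, which is a proper multiple of
  \<open>a k\<close>, so modulo proper multiples only the term at \<open>k\<^sup>2\<close>
  survives.\<close>

lemma lacunary_mult_nth:
  assumes a: "\<And>k. a k \<in> proper_multiples (a (Suc k))" and ik: "i \<le> k"
  shows "fps_nth (x * lacunary a E) (k\<^sup>2 + i) - (if k \<in> E then fps_nth x i * a k else 0)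
    \<in> proper_multiples (a k)"
proof -
  have chain: "a m \<in> proper_multiples (a k)" if "m < k" for m
    using that by (induction k) (auto simp: less_Suc_eq intro: a proper_multiples_trans)
  let ?t = "\<lambda>j. fps_nth (lacunary a E) j * fps_nth x (k\<^sup>2 + i - j)"
  have "fps_nth (x * lacunary a E) (k\<^sup>2 + i) = sum ?t {0..k\<^sup>2 + i}"
    by (simp add: fps_mult_nth mult.commute[of x])
  also have "\<dots> = ?t (k\<^sup>2) + sum ?t ({0..k\<^sup>2 + i} - {k\<^sup>2})"
    by (rule sum.remove) auto
  also have "?t (k\<^sup>2) = (if k \<in> E then fps_nth x i * a k else 0)"
    by (simp add: lacunary_nth_square)
  finally have "fps_nth (x * lacunary a E) (k\<^sup>2 + i) - (if k \<in> E then fps_nth x i * a k else 0)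
      = sum ?t ({0..k\<^sup>2 + i} - {k\<^sup>2})"
    by simp
  also have "\<dots> \<in> proper_multiples (a k)"
  proof (rule proper_multiples_sum)
    fix j assume j: "j \<in> {0..k\<^sup>2 + i} - {k\<^sup>2}"
    show "?t j \<in> proper_multiples (a k)"
    proof (cases "\<exists>m. j = m\<^sup>2")
      case True
      then obtain m where m: "j = m\<^sup>2" ..
      \<comment> \<open>This is where \<open>i \<le> k\<close> enters: \<open>k\<^sup>2 + i\<close>
        stays below the next square.\<close>
      have "m\<^sup>2 < (Suc k)\<^sup>2"
        using j m ik by (simp add: power2_eq_square)
      then have "m < Suc k" using power2_less_imp_less by blast
      with j m have "m < k" by (auto simp: less_Suc_eq)
      then have "fps_nth x (k\<^sup>2 + i - j) * a m \<in> proper_multiples (a k)"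
        by (intro proper_multiples_mult chain)
      then show ?thesis
        by (auto simp: m lacunary_nth_square mult.commute zero_proper_multiple)
    next
      case False
      then have "fps_nth (lacunary a E) j = 0" by (intro lacunary_nth_nonsquare) blast
      then show ?thesis by (simp add: zero_proper_multiple)
    qed
  qed
  finally show ?thesis .
qed

text \<open>At index \<open>k\<^sup>2 + i\<close> the right side has no leading term, as
  \<open>k\<close> is outside \<open>E'\<close>. So the leading term
  \<open>fps_nth u i * a k\<close> of the left side is itself a proper multiple of
  \<open>a k\<close>.\<close>

lemma lacunary_incomparable:
  assumes a: "\<And>k. a k \<in> proper_multiples (a (Suc k))" and nz: "\<And>k. a k \<noteq> 0"
    and k: "i \<le> k" "k \<in> E" "k \<notin> E'"
    and eq: "u * lacunary a E = h * lacunary a E'"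
  shows "fps_nth u i \<in> Q"
proof -
  have "fps_nth (h * lacunary a E') (k\<^sup>2 + i) \<in> proper_multiples (a k)"
    using lacunary_mult_nth[of a i k h E', OF a k(1)] k(3) by simp
  moreover have "fps_nth (h * lacunary a E') (k\<^sup>2 + i) - fps_nth u i * a k \<in> proper_multiples (a k)"
    using lacunary_mult_nth[of a i k u E, OF a k(1)] k(2) by (simp add: eq)
  ultimately have "fps_nth u i * a k \<in> proper_multiples (a k)"
    using proper_multiples_diff by fastforce
  then show ?thesis using nz by (rule mult_proper_multiple_imp_mem)
qed

section \<open>The localization as an overring\<close>

text \<open>A version of \<open>localization_at\<close> for a prime given by ring elements instead
  of their images in the quotient field.\<close>

definition local_ring :: "'a fract set" where
  "local_ring = {to_fract a / to_fract s | a s. s \<notin> Q}"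

lemma local_ringI: "s \<notin> Q \<Longrightarrow> x = to_fract a / to_fract s \<Longrightarrow> x \<in> local_ring"
  unfolding local_ring_def by blast

lemma local_ringE:
  assumes "x \<in> local_ring"
  obtains a s where "s \<notin> Q" "x = to_fract a / to_fract s"
  using assms unfolding local_ring_def by blast

lemma base_ring_subset_local_ring: "base_ring \<subseteq> local_ring"
  by (auto simp: base_ring_def intro: local_ringI[OF one_notin])

lemma local_ring_mult: "x \<in> local_ring \<Longrightarrow> y \<in> local_ring \<Longrightarrow> x * y \<in> local_ring"
proof (elim local_ringE)
  fix a s b t assume "s \<notin> Q" "x = to_fract a / to_fract s" "t \<notin> Q" "y = to_fract b / to_fract t"
  then show ?thesis
    by (intro local_ringI[of "s * t" _ "a * b"] mult_notin) auto
qed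

lemma local_ring_add: "x \<in> local_ring \<Longrightarrow> y \<in> local_ring \<Longrightarrow> x + y \<in> local_ring"
proof (elim local_ringE)
  fix a s b t
  assume *: "s \<notin> Q" "x = to_fract a / to_fract s" "t \<notin> Q" "y = to_fract b / to_fract t"
  then show ?thesis
    using notin_imp_nonzero[OF *(1)] notin_imp_nonzero[OF *(3)]
    by (intro local_ringI[of "s * t" _ "a * t + b * s"] mult_notin) (auto simp: field_simps)
qed

lemma local_ring_uminus: "x \<in> local_ring \<Longrightarrow> - x \<in> local_ring"
  by (auto elim!: local_ringE intro!: local_ringI[of _ _ "- _"])

lemma overring_local_ring: "overring local_ring"
  unfolding overring_def
  using base_ring_subset_local_ring local_ring_mult local_ring_add[OF _ local_ring_uminus]
  by fastforce

lemma localization_at_eq_local_ring: "localization_at (to_fract ` Q) = local_ring"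
proof (intro equalityI subsetI)
  fix x assume "x \<in> localization_at (to_fract ` Q)"
  then obtain a s where "x = to_fract a / to_fract s" "to_fract s \<notin> to_fract ` Q"
    unfolding localization_at_def base_ring_def by blast
  then show "x \<in> local_ring" by (intro local_ringI[of s x a]) auto
next
  fix x assume "x \<in> local_ring"
  then obtain a s where "s \<notin> Q" "x = to_fract a / to_fract s"
    by (rule local_ringE)
  moreover from this have "to_fract s \<in> base_ring - to_fract ` Q" by auto
  ultimately show "x \<in> localization_at (to_fract ` Q)"
    unfolding localization_at_def using to_fract_in_base_ring by blast
qed

end

section \<open>Uniformizer and factorization\<close>

text \<open>The condition on \<open>u\<close> says that it lies outside \<open>Q[[X]]\<close>, so
  \<open>fps_comparable\<close> is divisibility one way or the other in the localization
  there.\<close>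

locale comparable_prime_ideal = prime_ideal_set +
  assumes fps_comparable:
      "\<And>f g. \<exists>u h. (\<exists>i. fps_nth u i \<notin> Q) \<and> (u * f = h * g \<or> u * g = h * f)"
    and nonzero: "Q \<noteq> {0}"
begin

text \<open>Products with constants act coefficientwise, so the comparison can be read off at an
  index where \<open>u\<close> is outside \<open>Q\<close>.\<close>

lemma comparable: "\<exists>s c. s \<notin> Q \<and> (s * a = c * b \<or> s * b = c * a)"
proof -
  obtain u h i where "fps_nth u i \<notin> Q"
    and "u * fps_const a = h * fps_const b \<or> u * fps_const b = h * fps_const a"
    using fps_comparable by blast
  then show ?thesis by (metis fps_mult_right_const_nth)
qed

lemma no_descending_chain:
  assumes a: "\<And>k. a k \<in> proper_multiples (a (Suc k))" and nz: "\<And>k. a k \<noteq> 0"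
  shows False
proof -
  let ?E = "{k. even k}" and ?O = "{k. odd k}"
  obtain u h i where u: "fps_nth u i \<notin> Q"
    and "u * lacunary a ?E = h * lacunary a ?O \<or> u * lacunary a ?O = h * lacunary a ?E"
    using fps_comparable by blast
  then show False
  proof (elim disjE)
    assume "u * lacunary a ?E = h * lacunary a ?O"
    then have "fps_nth u i \<in> Q"
      \<comment> \<open>\<open>2 * i\<close> is an even index that is at least \<open>i\<close>; in
        the other case \<open>2 * i + 1\<close> is an odd one.\<close>
      by (intro lacunary_incomparable[of a i "2 * i" ?E ?O u h] a nz) auto
    with u show False ..
  next
    assume "u * lacunary a ?O = h * lacunary a ?E"
    then have "fps_nth u i \<in> Q"
      by (intro lacunary_incomparable[of a i "2 * i + 1" ?O ?E u h] a nz) auto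
    with u show False ..
  qed
qed

text \<open>The proper divisor comes first, so well-foundedness excludes endless passage to proper
  divisors. Zero must be left out, being a proper multiple of itself.\<close>

definition divides_properly :: "('a \<times> 'a) set" where
  "divides_properly = {(b, a). b \<noteq> 0 \<and> a \<noteq> 0 \<and> a \<in> proper_multiples b}"

lemma wf_divides_properly: "wf divides_properly"
  unfolding wf_iff_no_infinite_down_chain
proof
  assume "\<exists>f. \<forall>i. (f (Suc i), f i) \<in> divides_properly"
  then obtain f where "\<And>i. (f (Suc i), f i) \<in> divides_properly" by blast
  then show False
    by (intro no_descending_chain[of f]) (auto simp: divides_properly_def)
qed

text \<open>A minimal nonzero element of \<open>Q\<close> generates the maximal ideal of the
  localization: comparing it with \<open>x\<close>, either it divides \<open>x\<close> up to a
  factor outside \<open>Q\<close>, or \<open>x\<close> divides it properly, against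
  minimality.\<close>

lemma uniformizer_exists:
  "\<exists>p. p \<in> Q \<and> p \<noteq> 0 \<and> (\<forall>x\<in>Q. \<exists>s. s \<notin> Q \<and> p dvd s * x)"
proof -
  obtain p0 where p0: "p0 \<in> Q - {0}" using nonzero zero_mem by blast
  obtain p where p: "p \<in> Q - {0}"
    and min: "\<And>y. (y, p) \<in> divides_properly \<Longrightarrow> y \<notin> Q - {0}"
    by (rule wfE_min[OF wf_divides_properly p0]) blast
  have "\<exists>s. s \<notin> Q \<and> p dvd s * x" if x: "x \<in> Q" for x
  proof (cases "x = 0")
    case True
    then show ?thesis using one_notin by auto
  next
    case False
    obtain s c where s: "s \<notin> Q" and "s * x = c * p \<or> s * p = c * x"
      using comparable by blast
    then consider "s * x = c * p" | "s * p = c * x" "c \<in> Q" | "s * p = c * x" "c \<notin> Q"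
      by blast
    then show ?thesis
    proof cases
      case 1
      then show ?thesis using s by auto
    next
      case 2
      then have "p \<in> proper_multiples x"
        using s by (intro proper_multiplesI[of s c]) (auto simp: mult.commute)
      then show ?thesis using min[of x] x False p by (auto simp: divides_properly_def)
    next
      case 3
      then show ?thesis by (metis dvd_triv_right)
    qed
  qed
  with p show ?thesis by blast
qed

definition p :: 'a where
  "p = (SOME p. p \<in> Q \<and> p \<noteq> 0 \<and> (\<forall>x\<in>Q. \<exists>s. s \<notin> Q \<and> p dvd s * x))"

lemma p_mem: "p \<in> Q" and p_nonzero: "p \<noteq> 0"
  and p_dvd: "x \<in> Q \<Longrightarrow> \<exists>s. s \<notin> Q \<and> p dvd s * x"
  using someI_ex[OF uniformizer_exists] unfolding p_def by blast+

text \<open>Dividing \<open>a\<close> in \<open>Q\<close> by \<open>p\<close> gives a proper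
  divisor, so well-foundedness makes the division stop. This is what forces rank one.\<close>

lemma factorization:
  assumes "a \<noteq> 0"
  shows "\<exists>n s t. s \<notin> Q \<and> t \<notin> Q \<and> s * a = p ^ n * t"
  using assms
proof (induction a rule: wf_induct_rule[OF wf_divides_properly])
  case (1 a)
  show ?case
  proof (cases "a \<in> Q")
    case False
    then show ?thesis using one_notin by (intro exI[of _ 0] exI[of _ 1] exI[of _ a]) auto
  next
    case True
    then obtain s b where s: "s \<notin> Q" "s * a = p * b"
      using p_dvd by (metis dvdE)
    with 1(2) have "b \<noteq> 0"
      using notin_imp_nonzero[of s] by auto
    moreover have "a \<in> proper_multiples b"
      using s p_mem by (intro proper_multiplesI[of s p]) (auto simp: mult.commute)
    ultimately obtain n s' t where IH: "s' \<notin> Q" "t \<notin> Q" "s' * b = p ^ n * t"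
      using "1.IH"[of b] "1.prems" unfolding divides_properly_def by blast
    have "(s' * s) * a = p * (s' * b)" using s(2) by (simp add: mult_ac)
    also have "\<dots> = p ^ Suc n * t" unfolding IH(3) by (simp add: mult_ac)
    finally show ?thesis
      using mult_notin[OF IH(1) s(1)] IH(2)
      by (intro exI[of _ "Suc n"] exI[of _ "s' * s"] exI[of _ t]) auto
  qed
qed

section \<open>The valuation of the localization\<close>

text \<open>This is \<open>x = p^n\<close> times the unit \<open>t / s\<close> of the localization,
  with \<open>s\<close> cleared. It is a relation because existence and uniqueness of
  \<open>n\<close> need separate proofs.\<close>

definition has_value :: "'a fract \<Rightarrow> int \<Rightarrow> bool" where
  "has_value x n \<longleftrightarrow>
     (\<exists>s t. s \<notin> Q \<and> t \<notin> Q \<and> x * to_fract s = to_fract p powi n * to_fract t)"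

lemma has_valueI:
  "s \<notin> Q \<Longrightarrow> t \<notin> Q \<Longrightarrow> x * to_fract s = to_fract p powi n * to_fract t \<Longrightarrow> has_value x n"
  unfolding has_value_def by blast

lemma has_valueE:
  assumes "has_value x n"
  obtains s t where "s \<notin> Q" "t \<notin> Q" "x * to_fract s = to_fract p powi n * to_fract t"
  using assms unfolding has_value_def by blast

lemma has_value_exists_nat:
  assumes "a \<noteq> 0"
  shows "\<exists>n. has_value (to_fract a) (int n)"
proof -
  obtain n s t where "s \<notin> Q" "t \<notin> Q" and eq: "s * a = p ^ n * t"
    using factorization[OF assms] by blast
  moreover have "to_fract a * to_fract s = to_fract p powi int n * to_fract t"
    using arg_cong[OF eq, of to_fract] by (simp add: mult.commute to_fract_power)
  ultimately show ?thesis by (blast intro: has_valueI)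
qed

lemma has_value_mult:
  assumes "has_value x n" "has_value y m"
  shows "has_value (x * y) (n + m)"
proof -
  obtain s t s' t' where *: "s \<notin> Q" "t \<notin> Q" "x * to_fract s = to_fract p powi n * to_fract t"
    "s' \<notin> Q" "t' \<notin> Q" "y * to_fract s' = to_fract p powi m * to_fract t'"
    using assms by (metis has_valueE)
  have "x * y * to_fract (s * s') = (x * to_fract s) * (y * to_fract s')"
    by (simp only: to_fract_mult mult_ac)
  also have "\<dots> = to_fract p powi (n + m) * to_fract (t * t')"
  proof -
    have "to_fract p powi (n + m) = to_fract p powi n * to_fract p powi m"
      using p_nonzero by (intro power_int_add) simp
    then show ?thesis unfolding *(3) *(6) by (simp only: to_fract_mult mult_ac)
  qed
  finally show ?thesis using * by (intro has_valueI[of "s * s'" "t * t'"] mult_notin)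
qed

lemma has_value_inverse:
  assumes "has_value x n"
  shows "has_value (inverse x) (- n)"
proof -
  obtain s t where *: "s \<notin> Q" "t \<notin> Q" "x * to_fract s = to_fract p powi n * to_fract t"
    using assms by (rule has_valueE)
  note nz = *(1,2)[THEN notin_imp_nonzero] p_nonzero
  have "x \<noteq> 0" using * nz by auto
  then have "inverse x * to_fract t = to_fract p powi (- n) * to_fract s"
    using *(3) nz by (simp add: power_int_minus field_simps)
  with * show ?thesis by (intro has_valueI)
qed

lemma has_value_exists:
  assumes "x \<noteq> 0"
  shows "\<exists>n. has_value x n"
proof -
  obtain a b where ab: "b \<noteq> 0" "x = to_fract a * inverse (to_fract b)"
    using fract_quotientE[of x] by (metis divide_inverse)
  with assms have "a \<noteq> 0" by auto
  then obtain n m where "has_value (to_fract a) (int n)" "has_value (to_fract b) (int m)"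
    using has_value_exists_nat ab(1) by blast
  from has_value_mult[OF this(1) has_value_inverse[OF this(2)]] show ?thesis
    unfolding ab(2) ..
qed

lemma has_value_power: "has_value (to_fract p powi n) n"
  by (rule has_valueI[OF one_notin one_notin]) simp

text \<open>With a negative value, clearing denominators would equate \<open>r * t\<close>, a
  product of elements outside \<open>Q\<close>, with a multiple of \<open>p\<close>.\<close>

lemma local_ring_value_nonneg:
  assumes "x \<in> local_ring" "has_value x n"
  shows "0 \<le> n"
proof (rule ccontr)
  assume neg: "\<not> 0 \<le> n"
  obtain a r where x: "r \<notin> Q" "x = to_fract a / to_fract r"
    using assms(1) by (rule local_ringE)
  obtain s t where *: "s \<notin> Q" "t \<notin> Q" "x * to_fract s = to_fract p powi n * to_fract t"
    using assms(2) by (rule has_valueE)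
  define m where "m = nat (- n)"
  have n: "n = - int m" and m: "m \<noteq> 0" using neg by (auto simp: m_def)
  have clear: "c * w = d * (u * v)" if "u / c * v = inverse d * w" "c \<noteq> 0" "d \<noteq> 0"
    for c d u v w :: "'a fract"
    using that by (simp add: field_simps)
  have "to_fract a / to_fract r * to_fract s = inverse (to_fract (p ^ m)) * to_fract t"
    using *(3) by (simp only: n x(2) power_int_minus power_int_of_nat to_fract_power)
  then have "to_fract r * to_fract t = to_fract (p ^ m) * (to_fract a * to_fract s)"
    using notin_imp_nonzero[OF x(1)] p_nonzero by (intro clear) simp_all
  then have "r * t = p ^ m * (a * s)"
    by (simp only: to_fract_eq_iff flip: to_fract_mult)
  moreover have "p ^ m * (a * s) \<in> Q"
  proof -
    obtain k where "m = Suc k" using m not0_implies_Suc by blast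
    then have "p ^ m * (a * s) = (p ^ k * (a * s)) * p" by (simp only: power_Suc mult_ac)
    then show ?thesis by (simp only: mult_mem[OF p_mem])
  qed
  ultimately show False using mult_notin[OF x(1) *(2)] by simp
qed

lemma local_ring_if_value_nonneg:
  assumes "has_value x n" "0 \<le> n"
  shows "x \<in> local_ring"
proof -
  obtain s t where *: "s \<notin> Q" "t \<notin> Q" "x * to_fract s = to_fract p powi n * to_fract t"
    using assms(1) by (rule has_valueE)
  have "x = to_fract (p ^ nat n * t) / to_fract s"
    using *(3) assms(2) notin_imp_nonzero[OF *(1)] by (simp add: power_int_def to_fract_power field_simps)
  with *(1) show ?thesis by (rule local_ringI)
qed

text \<open>Two values of \<open>x\<close> make both of their differences values of
  \<open>x * inverse x = 1\<close>, which lies in the localization; so both differences are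
  nonnegative.\<close>

lemma has_value_unique:
  assumes "has_value x n" "has_value x m"
  shows "n = m"
proof -
  have "x \<noteq> 0"
    using assms(1) p_nonzero by (auto elim!: has_valueE dest: notin_imp_nonzero)
  then have "x * inverse x \<in> local_ring"
    using base_ring_subset_local_ring one_in_base_ring by auto
  then have "0 \<le> k + - l" if "has_value x k" "has_value x l" for k l
    using local_ring_value_nonneg[OF _ has_value_mult[OF that(1) has_value_inverse[OF that(2)]]]
    by simp
  from this[OF assms] this[OF assms(2,1)] show ?thesis by linarith
qed

definition val :: "'a fract \<Rightarrow> int" where
  "val x = (SOME n. has_value x n)"

lemma has_value_iff:
  assumes "x \<noteq> 0"
  shows "has_value x n \<longleftrightarrow> val x = n"
proof -
  have "has_value x (val x)"
    unfolding val_def using has_value_exists[OF assms] by (rule someI_ex)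
  then show ?thesis using has_value_unique by blast
qed

lemma val_mult: "x \<noteq> 0 \<Longrightarrow> y \<noteq> 0 \<Longrightarrow> val (x * y) = val x + val y"
  using has_value_mult[of x "val x" y "val y"] by (simp add: has_value_iff)

lemma val_power: "val (to_fract p powi n) = n"
  using has_value_power p_nonzero by (simp add: has_value_iff)

lemma local_ring_iff: "x \<in> local_ring \<longleftrightarrow> x = 0 \<or> 0 \<le> val x"
proof (cases "x = 0")
  case True
  then show ?thesis by (auto intro: local_ringI[OF one_notin, of _ 0])
next
  case False
  then have "has_value x (val x)" by (simp add: has_value_iff)
  with False show ?thesis
    using local_ring_value_nonneg local_ring_if_value_nonneg by auto
qed

text \<open>Scaling by a power of \<open>p\<close> makes the smaller value 0. The inequality then
  becomes closure of the localization under addition.\<close>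

lemma val_add:
  assumes "x \<noteq> 0" "y \<noteq> 0" "x + y \<noteq> 0"
  shows "min (val x) (val y) \<le> val (x + y)"
proof -
  define q where "q = to_fract p powi (- min (val x) (val y))"
  have q: "q \<noteq> 0" "val q = - min (val x) (val y)"
    using p_nonzero by (auto simp: q_def val_power)
  have "q * x \<in> local_ring" "q * y \<in> local_ring"
    using q assms by (auto simp: local_ring_iff val_mult)
  then have "q * (x + y) \<in> local_ring"
    using local_ring_add by (simp add: distrib_left)
  then show ?thesis
    using q assms by (simp add: local_ring_iff val_mult)
qed

lemma discrete_local_ring: "discrete_rank_one_valuation_domain local_ring"
  unfolding discrete_rank_one_valuation_domain_def
proof (intro exI[of _ val] conjI allI impI)
  show "val ` (UNIV - {0}) = UNIV"
  proof (intro equalityI subsetI)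
    fix n :: int
    have "to_fract p powi n \<noteq> 0" using p_nonzero by simp
    then have "val (to_fract p powi n) \<in> val ` (UNIV - {0})" by (intro imageI) simp
    then show "n \<in> val ` (UNIV - {0})" by (simp only: val_power)
  qed simp
next
  show "local_ring = {x. x = 0 \<or> 0 \<le> val x}" by (intro set_eqI) (simp add: local_ring_iff)
next
  fix x y :: "'a fract"
  assume "x \<noteq> 0" "y \<noteq> 0"
  then show "val (x * y) = val x + val y" by (rule val_mult)
next
  fix x y :: "'a fract"
  assume "x \<noteq> 0" "y \<noteq> 0" "x + y \<noteq> 0"
  then show "min (val x) (val y) \<le> val (x + y)" by (rule val_add)
qed

lemma valuation_overring_local_ring: "valuation_overring local_ring"
  unfolding valuation_overring_def
proof (intro conjI allI impI overring_local_ring)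
  fix x :: "'a fract"
  assume x: "x \<noteq> 0"
  have "val (inverse x) = - val x"
    using has_value_inverse[of x "val x"] x by (simp add: has_value_iff)
  then show "x \<in> local_ring \<or> inverse x \<in> local_ring"
    by (auto simp: local_ring_iff)
qed

end

section \<open>Complete integral closure and divisorial primes\<close>

text \<open>If \<open>x\<close> had negative value, the integer \<open>w r + n * w x\<close> would
  become negative for large \<open>n\<close>.\<close>

lemma discrete_rank_one_almost_integral:
  assumes "discrete_rank_one_valuation_domain V" "r \<noteq> 0" and V: "\<forall>n\<ge>1. r * x ^ n \<in> V"
  shows "x \<in> V"
proof -
  obtain w :: "_ \<Rightarrow> int" where
    mult: "\<And>x y. x \<noteq> 0 \<Longrightarrow> y \<noteq> 0 \<Longrightarrow> w (x * y) = w x + w y"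
    and Veq: "V = {x. x = 0 \<or> 0 \<le> w x}"
    using assms(1) unfolding discrete_rank_one_valuation_domain_def
    by (elim exE conjE) (rule that; simp)
  show ?thesis
  proof (rule ccontr)
    assume "x \<notin> V"
    then have x: "x \<noteq> 0" "w x \<le> - 1" by (auto simp: Veq)
    have w: "w (r * x ^ n) = w r + int n * w x" for n
    proof (induction n)
      case (Suc n)
      have "w (r * x ^ Suc n) = w (r * x ^ n) + w x"
        using mult[of "r * x ^ n" x] assms(2) x(1) by (simp add: mult_ac)
      with Suc show ?case by (simp add: algebra_simps)
    qed simp
    \<comment> \<open>This exceeds \<open>w r\<close> and is at least 1 even when \<open>w r\<close>
      is negative.\<close>
    define n where "n = nat (w r) + 1"
    have "1 \<le> n" by (simp add: n_def)
    with V have "r * x ^ n \<in> V" by blast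
    then have "0 \<le> w r + int n * w x"
      using assms(2) x(1) by (simp add: Veq flip: w)
    moreover have "int n * w x \<le> int n * (- 1)"
      using x(2) by (intro mult_left_mono) auto
    moreover have "w r < int n" by (simp add: n_def)
    ultimately show False by linarith
  qed
qed

text \<open>If the inverse of \<open>P\<close> were inside the base ring,
  \<open>v_closure P = P\<close> would contain the whole base ring. The fraction
  \<open>a / b\<close> is an element of that inverse outside the base ring.\<close>

lemma divisorial_inverse_witness:
  assumes "divisorial P" "prime_ideal_of_ring P"
  obtains a b where "b \<noteq> 0" "\<not> b dvd a" "\<And>q. to_fract q \<in> P \<Longrightarrow> b dvd a * q"
proof -
  have P: "P \<subseteq> base_ring" "P \<noteq> base_ring" "v_closure P = P"
    using assms by (auto simp: divisorial_def prime_ideal_of_ring_def ideal_of_ring_def)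
  have "\<not> ideal_inverse P \<subseteq> base_ring"
  proof
    assume "ideal_inverse P \<subseteq> base_ring"
    then have "base_ring \<subseteq> v_closure P"
      unfolding v_closure_def by (auto simp: ideal_inverse_def intro: base_ring_mult)
    with P show False by auto
  qed
  then obtain y where y: "y \<in> ideal_inverse P" "y \<notin> base_ring" by blast
  obtain a b where ab: "b \<noteq> 0" "y = to_fract a / to_fract b"
    by (rule fract_quotientE)
  have "b dvd a * q" if "to_fract q \<in> P" for q
  proof -
    have "to_fract (a * q) / to_fract b \<in> base_ring"
      using y(1) that by (auto simp: ideal_inverse_def ab)
    with quotient_in_base_ring_iff[OF ab(1)] show ?thesis ..
  qed
  with y ab show thesis by (intro that[of b a]) (auto simp: quotient_in_base_ring_iff)
qed

lemma localization_at_divisorial_prime: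
  fixes P :: "'a :: idom fract set"
  assumes pvmd: "pvmd TYPE('a fps)" and primeP: "prime_ideal_of_ring P" and div: "divisorial P"
  shows "essential_valuation_domain (localization_at P)"
    and "discrete_rank_one_valuation_domain (localization_at P)"
proof -
  define Q where "Q = {a. to_fract a \<in> P}"
  have sub: "frac_subspace P" and PD: "P \<subseteq> base_ring" "P \<noteq> base_ring"
    and pr: "\<And>a b. a \<in> base_ring \<Longrightarrow> b \<in> base_ring \<Longrightarrow> a * b \<in> P \<Longrightarrow> a \<in> P \<or> b \<in> P"
    using primeP by (auto simp: prime_ideal_of_ring_def ideal_of_ring_def)
  have P: "P = to_fract ` Q"
    using PD(1) by (auto simp: Q_def base_ring_def)
  obtain a b where ab: "b \<noteq> 0" "\<not> b dvd a" "\<And>q. to_fract q \<in> P \<Longrightarrow> b dvd a * q"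
    by (rule divisorial_inverse_witness[OF div primeP]) blast
  interpret comparable_prime_ideal Q
  proof
    show "0 \<in> Q" using frac.subspace_0[OF sub] by (simp add: Q_def)
    show "x + y \<in> Q" if "x \<in> Q" "y \<in> Q" for x y
      using frac.subspace_add[OF sub] that by (simp add: Q_def)
    show "r * x \<in> Q" if "x \<in> Q" for r x
      using frac.subspace_scale[OF sub] that by (simp add: Q_def)
    \<comment> \<open>The divisibility for \<open>q = 1\<close> would read
      \<open>b dvd a\<close>.\<close>
    show "1 \<notin> Q" using ab(2) ab(3)[of 1] by (auto simp: Q_def)
    show "x \<in> Q \<or> y \<in> Q" if "x * y \<in> Q" for x y
      using pr[of "to_fract x" "to_fract y"] that by (simp add: Q_def)
    show "\<exists>u h. (\<exists>i. fps_nth u i \<notin> Q) \<and> (u * f = h * g \<or> u * g = h * f)" for f g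
      by (rule pvmd_fps_comparable[OF pvmd _ ab(1,2)]) (simp add: Q_def ab(3))
    show "Q \<noteq> {0}"
      using div by (auto simp: P divisorial_def nonzero_fractional_ideal_def)
  qed
  have loc: "localization_at P = local_ring"
    using localization_at_eq_local_ring by (simp add: P)
  show "discrete_rank_one_valuation_domain (localization_at P)"
    unfolding loc by (rule discrete_local_ring)
  show "essential_valuation_domain (localization_at P)"
    unfolding essential_valuation_domain_def
    using valuation_overring_local_ring primeP loc by auto
qed

theorem theorem0p1:
  fixes F :: "'a :: idom fract set set"
  assumes "\<And>P. P \<in> F \<Longrightarrow> prime_ideal_of_ring P \<and> divisorial P"
    and "base_ring = (\<Inter>P\<in>F. localization_at P)"
    and "pvmd TYPE('a fps)"
  shows "v_domain TYPE('a) \<and>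
    (\<exists>\<V> :: 'a fract set set.
       (\<forall>V\<in>\<V>. essential_valuation_domain V \<and> discrete_rank_one_valuation_domain V) \<and>
       base_ring = \<Inter>\<V>) \<and>
    completely_integrally_closed TYPE('a)"
proof -
  let ?\<V> = "localization_at ` F"
  have \<V>: "\<forall>V\<in>?\<V>. essential_valuation_domain V \<and> discrete_rank_one_valuation_domain V"
    using assms(1) localization_at_divisorial_prime[OF assms(3)] by blast
  have "completely_integrally_closed TYPE('a)"
    unfolding completely_integrally_closed_def
  proof (intro allI impI)
    fix x r :: "'a fract"
    assume r: "r \<in> base_ring \<and> r \<noteq> 0 \<and> (\<forall>n\<ge>1. r * x ^ n \<in> base_ring)"
    have "x \<in> V" if V: "V \<in> ?\<V>" for V
    proof (rule discrete_rank_one_almost_integral)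
      show "discrete_rank_one_valuation_domain V" using \<V> V by blast
      show "r \<noteq> 0" using r by blast
      show "\<forall>n\<ge>1. r * x ^ n \<in> V" using r V assms(2) by blast
    qed
    then show "x \<in> base_ring" unfolding assms(2) by blast
  qed
  with \<V> assms(2) v_domain_if_completely_integrally_closed show ?thesis by blast
qed

end
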